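(* If $\gamma=\{\gamma_{m,n}\}_{(m,n)\in\mathfrak N}$ is a $(k,l)$-flat complex moment sequence for some $(k,l)$ (integers with $k\ge 0$) and $\mu$ is its representing measure, then one of the following conditions holds: (i) $\operatorname{supp}\mu\subset\{0\}\cup G_r$ for some integer $r\ge 1$, where $G_r=\{z\in\mathbb C: z^r=1\}$; (ii) $\operatorname{supp}\mu\subset\mathbb T$; (iii) $\operatorname{supp}\mu\subset\mathbb R$. Moreover, if $k\neq|l|$ (resp., $k=-l$, $k=l$), then condition (i) (resp., (ii), (iii)) holds. If additionally $k\neq|l|$ and $l\le 0$, then $0\notin\operatorname{supp}\mu$. Reversely, if $\gamma$ is a complex moment sequence with a representing measure $\mu$ satisfying one of the conditions (i)-(iii), then $\gamma$ is $(k,l)$-flat, where $$(k,l)=\begin{cases}(1,1)&\text{if (i) holds and } r=1,\\ (1,r-1)&\text{if (i) holds and } r>1,\\ (1,-1)&\text{if (ii) holds},\\ (1,1)&\text{if (iii) holds}.\end{cases}$$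
   Context: All measures are positive, and integrands are tacitly assumed to be absolutely integrable wherever integrals appear. Put $\mathbb T=\{z\in\mathbb C:|z|=1\}$ and $\mathfrak N=\{(m,n)\in\mathbb Z^2: m\ge 0,\ n\ge 0\}$. Convention: $0^0=1$. $\operatorname{supp}\mu$ is the closed support of a measure. A sequence $\gamma=\{\gamma_{m,n}\}_{(m,n)\in\mathfrak N}\subset\mathbb C$ is a complex moment sequence if there is a Borel measure $\mu$ on $\mathbb C$ with $\gamma_{m,n}=\int_{\mathbb C} z^m\bar z^n\,d\mu(z)$ for all $(m,n)\in\mathfrak N$; such $\mu$ is called a representing measure for $\gamma$. Given integers $k,l$ with $k\ge 0$, a sequence $\gamma=\{\gamma_{m,n}\}_{(m,n)\in\mathfrak N}\subset\mathbb C$ is called $(k,l)$-flat if $\gamma_{m,n}=\gamma_{m',n'}$ whenever $(m,n),(m',n')\in\mathfrak N$ and $km+ln=km'+ln'$. *)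

theory Defs
  imports "HOL-Analysis.Analysis"
begin

text \<open>
  The index set \<open>{(m, n) \<in> \<int>\<^sup>2. m \<ge> 0 \<and> n \<ge> 0}\<close> is rendered by the curried type \<open>nat \<Rightarrow> nat \<Rightarrow> complex\<close>.
  Integrability is demanded explicitly because the Bochner integral of a
  non-integrable function is \<open>0\<close> by convention; the case \<open>m = n = 0\<close> makes \<open>\<mu>\<close> finite.
\<close>

definition representing_measure :: "complex measure \<Rightarrow> (nat \<Rightarrow> nat \<Rightarrow> complex) \<Rightarrow> bool" where
  "representing_measure \<mu> \<gamma> \<longleftrightarrow>
     sets \<mu> = sets borel \<and>
     (\<forall>m n. integrable \<mu> (\<lambda>z. z ^ m * cnj z ^ n) \<and>
            \<gamma> m n = (\<integral>z. z ^ m * cnj z ^ n \<partial>\<mu>))"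

definition complex_moment_sequence :: "(nat \<Rightarrow> nat \<Rightarrow> complex) \<Rightarrow> bool" where
  "complex_moment_sequence \<gamma> \<longleftrightarrow> (\<exists>\<mu>. representing_measure \<mu> \<gamma>)"

text \<open>The standing requirement \<open>k \<ge> 0\<close> is a hypothesis wherever this notion is used.\<close>

definition flat :: "int \<Rightarrow> int \<Rightarrow> (nat \<Rightarrow> nat \<Rightarrow> complex) \<Rightarrow> bool" where
  "flat k l \<gamma> \<longleftrightarrow>
     (\<forall>m n m' n'. k * int m + l * int n = k * int m' + l * int n' \<longrightarrow> \<gamma> m n = \<gamma> m' n')"

definition closed_support :: "'a::topological_space measure \<Rightarrow> 'a set" where
  "closed_support \<mu> = {x. \<forall>U. open U \<and> x \<in> U \<longrightarrow> emeasure \<mu> U > 0}"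

definition unit_circle :: "complex set" where
  "unit_circle = {z. cmod z = 1}"

definition roots_of_one :: "nat \<Rightarrow> complex set" where
  "roots_of_one r = {z. z ^ r = 1}"

end

theory Submission
  imports Defs
begin

text \<open>
  The theorem rests on one equivalence: the moments depend on \<open>(m, n)\<close> only through the weight
  \<open>k * m + l * n\<close> if and only if the monomials \<open>z ^ m * cnj z ^ n\<close> themselves depend only on that
  weight at every point \<open>z\<close> of the support (\<open>flat_iff_monomials_agree_on_support\<close>). From right to
  left one integrates, the complement of the support being a null set. From left to right, let \<open>p\<close>
  and \<open>q\<close> be two monomials of equal weight. Expanding \<open>(p - q) * cnj (p - q)\<close> gives four monomials,
  and the equality of the weights of \<open>p\<close> and \<open>q\<close> makes each mixed term \<open>p * cnj q\<close>, \<open>q * cnj p\<close>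
  have the same weight as one of the two squares. So flatness cancels the four moments against each
  other, \<open>\<integral>|p - q|\<^sup>2 = 0\<close>, and the continuous functions \<open>p\<close> and \<open>q\<close> agree on the support.

  What remains concerns a single complex number \<open>z\<close> in the support, and suitable pairs of
  monomials decide it:
  \<^item> \<open>k = l\<close>: the monomials \<open>z\<close> and \<open>cnj z\<close> have equal weight, so \<open>z\<close> is real;
  \<^item> \<open>k = - l\<close>: the monomials \<open>z * cnj z\<close> and \<open>1\<close> have equal weight, so \<open>|z| = 1\<close>;
  \<^item> \<open>l \<ge> 0\<close>, \<open>k \<noteq> l\<close>: from \<open>z ^ l = cnj z ^ k\<close> one gets \<open>z = 0\<close> or \<open>|z| = 1\<close>, and in the latter
    case \<open>z ^ (k + l) = 1\<close>;
  \<^item> \<open>l \<le> 0\<close>, \<open>k \<noteq> - l\<close>: from \<open>z ^ (- l) * cnj z ^ k = 1\<close> one gets \<open>|z| = 1\<close> and then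
    \<open>z ^ \<bar>k + l\<bar> = 1\<close>.
\<close>

section \<open>The closed support of a Borel measure\<close>

lemma closed_support_subset:
  fixes M :: "'a::topological_space measure"
  assumes sets: "sets M = sets borel" and "closed S" and AE: "AE x in M. x \<in> S"
  shows "closed_support M \<subseteq> S"
proof
  fix x assume x: "x \<in> closed_support M"
  have op: "open (- S)"
    using \<open>closed S\<close> by (simp add: open_Compl)
  then have "- S \<in> sets M"
    by (simp add: sets)
  moreover have "AE x in M. x \<notin> - S"
    using AE by simp
  ultimately have "emeasure M (- S) = 0"
    by (simp add: AE_iff_null_sets[symmetric] null_setsD1 del: Compl_iff)
  with x op show "x \<in> S"
    by (force simp: closed_support_def)
qed

text \<open>
  The complement of the support is the union of all open null sets; second countability reduces it
  to a countable union.
\<close>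

lemma AE_in_closed_support:
  fixes M :: "'a::second_countable_topology measure"
  assumes sets: "sets M = sets borel"
  shows "AE x in M. x \<in> closed_support M"
proof -
  define \<U> where "\<U> = {U. open U \<and> emeasure M U = 0}"
  obtain \<V> where \<V>: "\<V> \<subseteq> \<U>" "countable \<V>" "\<Union>\<V> = \<Union>\<U>"
    using Lindelof[of \<U>] by (auto simp: \<U>_def)
  have "AE x in M. \<forall>U\<in>\<V>. x \<notin> U"
  proof (subst AE_ball_countable[OF \<V>(2)], intro ballI)
    fix U assume "U \<in> \<V>"
    with \<V>(1) have "U \<in> null_sets M"
      by (auto simp: \<U>_def sets intro!: null_setsI)
    then show "AE x in M. x \<notin> U"
      by (rule AE_not_in)
  qed
  then show ?thesis
  proof (rule eventually_mono)
    fix x assume "\<forall>U\<in>\<V>. x \<notin> U"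
    then have "x \<notin> \<Union>\<U>"
      using \<V>(3) by blast
    then show "x \<in> closed_support M"
      by (auto simp: \<U>_def closed_support_def zero_less_iff_neq_zero)
  qed
qed

section \<open>Flatness as a pointwise property of the support\<close>

text \<open>
  Under the moment identity in the hypothesis, \<open>\<integral>|p - q|\<^sup>2 = 0\<close> for the monomials
  \<open>p = z ^ a * cnj z ^ b\<close> and \<open>q = z ^ c * cnj z ^ d\<close>: its four terms are the squares and the mixed
  products after expansion.
\<close>

lemma monomials_agree_on_support:
  assumes rep: "representing_measure \<mu> \<gamma>"
    and \<gamma>: "\<gamma> (a + b) (a + b) + \<gamma> (c + d) (c + d) = \<gamma> (a + d) (b + c) + \<gamma> (b + c) (a + d)"
    and z: "z \<in> closed_support \<mu>"
  shows "z ^ a * cnj z ^ b = z ^ c * cnj z ^ d"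
proof -
  define m :: "nat \<Rightarrow> nat \<Rightarrow> complex \<Rightarrow> complex" where "m i j = (\<lambda>z. z ^ i * cnj z ^ j)" for i j
  have sets: "sets \<mu> = sets borel"
    and int: "integrable \<mu> (m i j)" and mom: "\<gamma> i j = (\<integral>z. m i j z \<partial>\<mu>)" for i j
    using rep by (auto simp: representing_measure_def m_def)
  let ?e = "\<lambda>z. (cmod (m a b z - m c d z))\<^sup>2"
  let ?F = "\<lambda>z. m (a + b) (a + b) z + m (c + d) (c + d) z
                  - (m (a + d) (b + c) z + m (b + c) (a + d) z)"
  have expand: "complex_of_real (?e z) = ?F z" for z
    unfolding complex_norm_square
    by (simp add: m_def power_add algebra_simps)
  have int_F: "integrable \<mu> ?F"
    by (intro Bochner_Integration.integrable_diff Bochner_Integration.integrable_add int)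
  have "(\<integral>z. ?F z \<partial>\<mu>) = 0"
    using \<gamma> by (simp add: int mom)
  moreover have "(\<integral>z. ?F z \<partial>\<mu>) = complex_of_real (\<integral>z. ?e z \<partial>\<mu>)"
    unfolding expand[symmetric] by (rule integral_complex_of_real)
  ultimately have "(\<integral>z. ?e z \<partial>\<mu>) = 0"
    by simp
  moreover have "integrable \<mu> ?e"
    using int_F unfolding expand[symmetric] by (simp only: complex_of_real_integrable_eq)
  ultimately have "AE z in \<mu>. ?e z = 0"
    by (simp add: integral_nonneg_eq_0_iff_AE)
  then have "AE z in \<mu>. z \<in> {z. m a b z = m c d z}"
    by simp
  moreover have "closed {z. m a b z = m c d z}"
    unfolding m_def by (intro closed_Collect_eq continuous_intros)
  ultimately have "closed_support \<mu> \<subseteq> {z. m a b z = m c d z}"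
    by (intro closed_support_subset[OF sets])
  with z have "m a b z = m c d z"
    by blast
  then show ?thesis
    by (simp only: m_def)
qed

theorem flat_iff_monomials_agree_on_support:
  assumes rep: "representing_measure \<mu> \<gamma>"
  shows "flat k l \<gamma> \<longleftrightarrow>
    (\<forall>z\<in>closed_support \<mu>. \<forall>a b c d. k * int a + l * int b = k * int c + l * int d \<longrightarrow>
       z ^ a * cnj z ^ b = z ^ c * cnj z ^ d)"
proof (intro iffI ballI allI impI)
  fix z a b c d
  assume flat: "flat k l \<gamma>" and z: "z \<in> closed_support \<mu>"
    and weight: "k * int a + l * int b = k * int c + l * int d"
  have "\<gamma> (a + b) (a + b) = \<gamma> (b + c) (a + d)" "\<gamma> (c + d) (c + d) = \<gamma> (a + d) (b + c)"
    using flat weight by (simp_all add: flat_def algebra_simps)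
  then show "z ^ a * cnj z ^ b = z ^ c * cnj z ^ d"
    by (intro monomials_agree_on_support[OF rep _ z]) simp
next
  assume *: "\<forall>z\<in>closed_support \<mu>. \<forall>a b c d.
    k * int a + l * int b = k * int c + l * int d \<longrightarrow> z ^ a * cnj z ^ b = z ^ c * cnj z ^ d"
  have sets: "sets \<mu> = sets borel"
    and int: "integrable \<mu> (\<lambda>z. z ^ i * cnj z ^ j)"
    and mom: "\<gamma> i j = (\<integral>z. z ^ i * cnj z ^ j \<partial>\<mu>)" for i j
    using rep by (auto simp: representing_measure_def)
  show "flat k l \<gamma>"
    unfolding flat_def
  proof (intro allI impI)
    fix a b c d
    assume weight: "k * int a + l * int b = k * int c + l * int d"
    have "AE z in \<mu>. z ^ a * cnj z ^ b = z ^ c * cnj z ^ d"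
      using AE_in_closed_support[OF sets] by (rule eventually_mono) (use * weight in blast)
    then show "\<gamma> a b = \<gamma> c d"
      unfolding mom by (intro integral_cong_AE borel_measurable_integrable int)
  qed
qed

section \<open>Complex numbers whose monomials depend only on the weight\<close>

lemma cnj_eq_inverse: "cmod z = 1 \<Longrightarrow> cnj z = inverse z"
  using complex_norm_square[of z] by (simp add: inverse_unique)

lemma root_of_one_imp_norm_1: "z ^ r = 1 \<Longrightarrow> r \<ge> 1 \<Longrightarrow> cmod z = 1"
  using power_eq_1_iff[of "cmod z" r] by (auto simp flip: norm_power)

text \<open>Comparing moduli forces \<open>|z| = 1\<close>, and on the circle \<open>cnj z\<close> is the inverse of \<open>z\<close>.\<close>

lemma power_eq_cnj_power_imp_root_of_one:
  assumes eq: "z ^ j = cnj z ^ k" and "j \<noteq> k" and "z \<noteq> 0"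
  shows "z ^ (k + j) = 1"
proof -
  have "cmod z ^ j = cmod z ^ k"
    using arg_cong[OF eq, of cmod] by (simp add: norm_power)
  then have "cmod z = 1"
    using \<open>j \<noteq> k\<close> \<open>z \<noteq> 0\<close> power_inject_exp[of "cmod z" j k]
      power_strict_decreasing[of j k "cmod z"] power_strict_decreasing[of k j "cmod z"]
    by (cases "cmod z" "1 :: real" rule: linorder_cases; cases j k rule: linorder_cases) simp_all
  with eq \<open>z \<noteq> 0\<close> show ?thesis
    by (simp add: cnj_eq_inverse power_add power_inverse)
qed

lemma power_cnj_power_eq_1_imp_root_of_one:
  assumes eq: "z ^ j * cnj z ^ k = 1" and "j \<noteq> k"
  shows "z ^ nat \<bar>int k - int j\<bar> = 1"
proof -
  have "cmod z ^ (j + k) = 1"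
    using arg_cong[OF eq, of cmod] by (simp add: norm_mult norm_power power_add)
  with \<open>j \<noteq> k\<close> have norm: "cmod z = 1"
    using power_eq_1_iff[of "cmod z" "j + k"] by auto
  then have "z \<noteq> 0"
    by auto
  have "z ^ j = z ^ k"
    using eq norm \<open>z \<noteq> 0\<close> by (simp add: cnj_eq_inverse power_inverse field_simps)
  then have "z ^ (max j k - min j k) = 1"
    using \<open>z \<noteq> 0\<close> by (simp add: power_diff max_def min_def)
  moreover have "nat \<bar>int k - int j\<bar> = max j k - min j k"
    by auto
  ultimately show ?thesis
    by simp
qed

text \<open>
  At \<open>0\<close> the condition \<open>r > 1\<close> matters: with \<open>r = 1\<close> the weight \<open>a + (r - 1) * b\<close> would vanish for
  the monomial \<open>cnj z\<close> as well as for \<open>1\<close>.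
\<close>

lemma monomials_agree_root_of_one:
  assumes r: "r > 1" and z: "z = 0 \<or> z ^ r = 1"
    and weight: "a + (r - 1) * b = c + (r - 1) * d"
  shows "z ^ a * cnj z ^ b = z ^ c * cnj z ^ d"
proof -
  have mono: "z ^ i * cnj z ^ j = z ^ (i + (r - 1) * j)" for i j
  proof (cases "z = 0")
    case True
    with r show ?thesis
      by (cases "i = 0"; cases "j = 0") (simp_all add: zero_power)
  next
    case False
    with z have "z ^ r = 1"
      by simp
    then have "cnj z = inverse z"
      using r by (intro cnj_eq_inverse root_of_one_imp_norm_1[of z r]) auto
    also have "\<dots> = z ^ (r - 1)"
      using \<open>z ^ r = 1\<close> r
      by (metis One_nat_def Suc_pred' inverse_unique less_trans power_Suc zero_less_one)
    finally show ?thesis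
      by (simp add: power_add power_mult)
  qed
  show ?thesis
    using mono[of a b] mono[of c d] weight by simp
qed

section \<open>Supports of measures with flat moments\<close>

theorem theorem8:
  fixes \<gamma> :: "nat \<Rightarrow> nat \<Rightarrow> complex" and \<mu> :: "complex measure"
  assumes "complex_moment_sequence \<gamma>"
    and "representing_measure \<mu> \<gamma>"
  shows
    "(\<forall>k l :: int. k \<ge> 0 \<and> flat k l \<gamma> \<longrightarrow>
        ((\<exists>r\<ge>1. closed_support \<mu> \<subseteq> {0} \<union> roots_of_one r) \<or>
         closed_support \<mu> \<subseteq> unit_circle \<or>
         closed_support \<mu> \<subseteq> \<real>) \<and>
        (k \<noteq> \<bar>l\<bar> \<longrightarrow> (\<exists>r\<ge>1. closed_support \<mu> \<subseteq> {0} \<union> roots_of_one r)) \<and>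
        (k = - l \<longrightarrow> closed_support \<mu> \<subseteq> unit_circle) \<and>
        (k = l \<longrightarrow> closed_support \<mu> \<subseteq> \<real>) \<and>
        (k \<noteq> \<bar>l\<bar> \<and> l \<le> 0 \<longrightarrow> 0 \<notin> closed_support \<mu>)) \<and>
     (\<forall>r\<ge>1. closed_support \<mu> \<subseteq> {0} \<union> roots_of_one r \<longrightarrow>
        (r = 1 \<longrightarrow> flat 1 1 \<gamma>) \<and> (r > 1 \<longrightarrow> flat 1 (int r - 1) \<gamma>)) \<and>
     (closed_support \<mu> \<subseteq> unit_circle \<longrightarrow> flat 1 (- 1) \<gamma>) \<and>
     (closed_support \<mu> \<subseteq> \<real> \<longrightarrow> flat 1 1 \<gamma>)"
proof -
  note flat_iff = flat_iff_monomials_agree_on_support[OF assms(2)]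
  let ?S = "closed_support \<mu>"
  have forward:
    "(k \<noteq> \<bar>l\<bar> \<longrightarrow> (\<exists>r\<ge>1. ?S \<subseteq> {0} \<union> roots_of_one r)) \<and>
     (k = - l \<longrightarrow> ?S \<subseteq> unit_circle) \<and> (k = l \<longrightarrow> ?S \<subseteq> \<real>) \<and>
     (k \<noteq> \<bar>l\<bar> \<and> l \<le> 0 \<longrightarrow> 0 \<notin> ?S)"
    if k: "k \<ge> 0" and "flat k l \<gamma>" for k l :: int
  proof (intro conjI impI)
    have agree: "z ^ a * cnj z ^ b = z ^ c * cnj z ^ d"
      if "z \<in> ?S" "k * int a + l * int b = k * int c + l * int d" for z a b c d
      using \<open>flat k l \<gamma>\<close> that unfolding flat_iff by blast
    have pos: "z ^ nat l = cnj z ^ nat k" if "z \<in> ?S" "l \<ge> 0" for z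
      using agree[OF that(1), of "nat l" 0 0 "nat k"] that k by simp
    have neg: "z ^ nat (- l) * cnj z ^ nat k = 1" if "z \<in> ?S" "l \<le> 0" for z
      using agree[OF that(1), of "nat (- l)" "nat k" 0 0] that k by simp
    show "\<exists>r\<ge>1. ?S \<subseteq> {0} \<union> roots_of_one r" if "k \<noteq> \<bar>l\<bar>"
    proof (cases "l \<ge> 0")
      case True
      then have "nat l \<noteq> nat k"
        using k that by auto
      then have "?S \<subseteq> {0} \<union> roots_of_one (nat k + nat l)"
        using power_eq_cnj_power_imp_root_of_one pos True by (auto simp: roots_of_one_def)
      then show ?thesis
        using \<open>nat l \<noteq> nat k\<close> by (intro exI[of _ "nat k + nat l"]) auto
    next
      case False
      then have "nat (- l) \<noteq> nat k"
        using k that by auto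
      have "z ^ nat \<bar>k + l\<bar> = 1" if "z \<in> ?S" for z
        using power_cnj_power_eq_1_imp_root_of_one[OF neg[OF that] \<open>nat (- l) \<noteq> nat k\<close>] k False
        by simp
      moreover have "nat \<bar>k + l\<bar> \<ge> 1"
        using \<open>k \<noteq> \<bar>l\<bar>\<close> False by linarith
      ultimately show ?thesis
        by (intro exI[of _ "nat \<bar>k + l\<bar>"]) (auto simp: roots_of_one_def)
    qed
    show "?S \<subseteq> unit_circle" if "k = - l"
    proof
      fix z assume "z \<in> ?S"
      then have "z * cnj z = 1"
        using agree[of z 1 1 0 0] that by simp
      then have "(cmod z)\<^sup>2 = 1"
        by (metis complex_norm_square of_real_eq_1_iff)
      then show "z \<in> unit_circle"
        using power_eq_1_iff[of "cmod z" 2] by (simp add: unit_circle_def)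
    qed
    show "?S \<subseteq> \<real>" if "k = l"
    proof
      fix z assume "z \<in> ?S"
      then have "z = cnj z"
        using agree[of z 1 0 0 1] that by simp
      then show "z \<in> \<real>"
        by (simp add: Reals_cnj_iff)
    qed
    show "0 \<notin> ?S" if "k \<noteq> \<bar>l\<bar> \<and> l \<le> 0"
      using neg[of 0] that k by (cases "l = 0") (auto simp: zero_power)
  qed

  have roots: "flat 1 (int r - 1) \<gamma>" if "r > 1" "?S \<subseteq> {0} \<union> roots_of_one r" for r
    unfolding flat_iff
  proof (intro ballI allI impI)
    fix z a b c d
    assume z: "z \<in> ?S" and w: "1 * int a + (int r - 1) * int b = 1 * int c + (int r - 1) * int d"
    have "int (a + (r - 1) * b) = int (c + (r - 1) * d)"
      using w \<open>r > 1\<close> by (simp add: of_nat_diff)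
    then have "a + (r - 1) * b = c + (r - 1) * d"
      by (simp only: of_nat_eq_iff)
    then show "z ^ a * cnj z ^ b = z ^ c * cnj z ^ d"
      using z that by (intro monomials_agree_root_of_one[of r]) (auto simp: roots_of_one_def)
  qed

  have circle: "flat 1 (- 1) \<gamma>" if "?S \<subseteq> unit_circle"
    unfolding flat_iff
  proof (intro ballI allI impI)
    fix z a b c d
    assume "z \<in> ?S" and w: "1 * int a + (- 1) * int b = 1 * int c + (- 1) * int d"
    then have norm: "cmod z = 1" and "a + d = c + b"
      using that by (auto simp: unit_circle_def)
    then have "z \<noteq> 0" and "z ^ a * z ^ d = z ^ c * z ^ b"
      by (auto simp flip: power_add)
    then show "z ^ a * cnj z ^ b = z ^ c * cnj z ^ d"
      using norm by (simp add: cnj_eq_inverse power_inverse field_simps)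
  qed

  have reals: "flat 1 1 \<gamma>" if "?S \<subseteq> \<real>"
    unfolding flat_iff
  proof (intro ballI allI impI)
    fix z a b c d
    assume "z \<in> ?S" and "1 * int a + 1 * int b = 1 * int c + 1 * int d"
    then have "cnj z = z" and "a + b = c + d"
      using that by (auto simp: Reals_cnj_iff)
    then show "z ^ a * cnj z ^ b = z ^ c * cnj z ^ d"
      by (simp flip: power_add)
  qed

  (* The case r = 1: the support lies in {0, 1}, hence on the real line. *)
  have root_1: "flat 1 1 \<gamma>" if "?S \<subseteq> {0} \<union> roots_of_one 1"
    using that by (intro reals) (auto simp: roots_of_one_def)

  have trichotomy: "(\<exists>r\<ge>1. ?S \<subseteq> {0} \<union> roots_of_one r) \<or> ?S \<subseteq> unit_circle \<or> ?S \<subseteq> \<real>"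
    if "k \<ge> 0" "flat k l \<gamma>" for k l :: int
  proof -
    have "k \<noteq> \<bar>l\<bar> \<or> k = - l \<or> k = l"
      by linarith
    with forward[OF that] show ?thesis
      by argo
  qed

  show ?thesis
  proof (rule conjI, intro allI impI, elim conjE, rule conjI)
    fix k l :: int
    assume kl: "k \<ge> 0" "flat k l \<gamma>"
    show "(\<exists>r\<ge>1. ?S \<subseteq> {0} \<union> roots_of_one r) \<or> ?S \<subseteq> unit_circle \<or> ?S \<subseteq> \<real>"
      using kl by (rule trichotomy)
    show "(k \<noteq> \<bar>l\<bar> \<longrightarrow> (\<exists>r\<ge>1. ?S \<subseteq> {0} \<union> roots_of_one r)) \<and>
        (k = - l \<longrightarrow> ?S \<subseteq> unit_circle) \<and> (k = l \<longrightarrow> ?S \<subseteq> \<real>) \<and>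
        (k \<noteq> \<bar>l\<bar> \<and> l \<le> 0 \<longrightarrow> 0 \<notin> ?S)"
      using kl by (rule forward)
  qed (use root_1 roots circle reals in \<open>intro conjI allI impI; simp\<close>)
qed

end
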